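(* For each $n=2,3,\ldots$, the family of Laurent polynomials $\{L_n(z,G)\}_G$, where $G$ runs over the set of all generic $2\times2$ complex matrices, is a three-parametric family, and the representation $L_n(z,G)=R^nL_n(\rho z,F_\theta)$ is a parametrization of it by free parameters $R,\rho,\theta$, in the following sense: (1) Given a generic complex $2\times2$ matrix $G$, there exist $R\in(0,\infty)$, $\rho\in(0,\infty)$, $\theta\in[0,\pi/4]$ such that for every $n=1,2,3,\ldots$ $$L_n(z,G)=R^nL_n(\rho z,F_\theta)\qquad\text{for all } z\in\mathbb{C}\setminus\{0\}.$$ (2) Given any triple $(R,\rho,\theta)$ with $R\in(0,\infty)$, $\rho\in(0,\infty)$, $\theta\in[0,\pi/4]$, there exists a generic complex $2\times2$ matrix $G_{R,\rho,\theta}$ such that $L_n(z,G_{R,\rho,\theta})=R^nL_n(\rho z,F_\theta)$ for all $z\in\mathbb{C}\setminus\{0\}$ and every $n=1,2,3,\ldots$. (3) Let $(R_1,\rho_1,\theta_1)$ and $(R_2,\rho_2,\theta_2)$ be triples with $R_j,\rho_j\in(0,\infty)$, $\theta_j\in[0,\pi/4]$ ($j=1,2$). If for some $n\ge2$ the functions $R_1^nL_n(\rho_1z,F_{\theta_1})$ and $R_2^nL_n(\rho_2z,F_{\theta_2})$ of $z\in\mathbb{C}\setminus\{0\}$ coincide, then $R_1=R_2$, $\rho_1=\rho_2$ and $\theta_1=\theta_2$. If the functions $R_1L_1(\rho_1z,F_{\theta_1})$ and $R_2L_1(\rho_2z,F_{\theta_2})$ coincide, then $R_1=R_2$ and $\rho_1=\rho_2$,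 but $\theta_1,\theta_2$ can be arbitrary (i.e. for all $R,\rho\in(0,\infty)$ and all $\theta_1,\theta_2\in[0,\pi/4]$ the functions $R\,L_1(\rho z,F_{\theta_1})$ and $R\,L_1(\rho z,F_{\theta_2})$ coincide).
   Context: For a complex $2\times 2$ matrix $G=\begin{bmatrix}g_{11}&g_{12}\\ g_{21}&g_{22}\end{bmatrix}$, $G^*$ is its Hermitian conjugate. For $z\in\mathbb{C}\setminus\{0\}$ and $n=1,2,3,\ldots$ put $$S(z,G)=G\begin{bmatrix}z&0\\0&z^{-1}\end{bmatrix}G^{*},\qquad L_n(z,G)=\operatorname{tr}\big(S(z,G)^n\big).$$ The matrix $G$ is called generic if $(|g_{11}|^2+|g_{21}|^2)(|g_{12}|^2+|g_{22}|^2)\neq0$. For real $\theta$, $F_\theta=\begin{bmatrix}\cos\theta&\sin\theta\\ \sin\theta&\cos\theta\end{bmatrix}$. *)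

theory Defs
  imports "HOL-Analysis.Analysis"
begin

definition mat2 :: "'a::zero \<Rightarrow> 'a \<Rightarrow> 'a \<Rightarrow> 'a \<Rightarrow> 'a^2^2" where
  "mat2 a b c d = vector [vector [a, b], vector [c, d]]"

definition adjoint_mat :: "complex^'n^'m \<Rightarrow> complex^'m^'n" where
  "adjoint_mat A = map_matrix cnj (transpose A)"

text \<open>On the type of square matrices, the overloaded operations for products and powers act
  entry by entry; the powers below are those of the matrix product.\<close>

definition mat_power :: "'a::semiring_1^'n^'n \<Rightarrow> nat \<Rightarrow> 'a^'n^'n" where
  "mat_power A n = (((**) A) ^^ n) (mat 1)"

definition S :: "complex \<Rightarrow> complex^2^2 \<Rightarrow> complex^2^2" where
  "S z G = G ** mat2 z 0 0 (inverse z) ** adjoint_mat G"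

definition L :: "nat \<Rightarrow> complex \<Rightarrow> complex^2^2 \<Rightarrow> complex" where
  "L n z G = trace (mat_power (S z G) n)"

definition generic :: "complex^2^2 \<Rightarrow> bool" where
  "generic G \<longleftrightarrow>
    ((cmod (G $ 1 $ 1))\<^sup>2 + (cmod (G $ 2 $ 1))\<^sup>2) *
    ((cmod (G $ 1 $ 2))\<^sup>2 + (cmod (G $ 2 $ 2))\<^sup>2) \<noteq> 0"

definition F :: "real \<Rightarrow> complex^2^2" where
  "F \<theta> = mat2 (of_real (cos \<theta>)) (of_real (sin \<theta>)) (of_real (sin \<theta>)) (of_real (cos \<theta>))"

end

theory Submission
  imports Defs "HOL-Computational_Algebra.Polynomial"
begin

text \<open>By Cayley--Hamilton, the traces of the powers of a \<open>2 \<times> 2\<close> matrix satisfy a two-term recurrence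
  determined by its trace and determinant. For \<open>S z G\<close> these are \<open>u z + v / z\<close> and \<open>d\<close>, where \<open>u\<close> and \<open>v\<close>
  are the squared norms of the columns of \<open>G\<close> and \<open>d = \<bar>det G\<bar>\<^sup>2\<close>; Hadamard's inequality \<open>d \<le> u v\<close> gives
  the normal form \<open>u = R \<rho>\<close>, \<open>v = R / \<rho>\<close>, \<open>d = R\<^sup>2 cos\<^sup>2 (2 \<theta>)\<close>. Conversely, \<open>z\<^sup>n L\<^sub>n\<close> is a polynomial in \<open>z\<^sup>2\<close>
  whose two lowest coefficients are \<open>v\<^sup>n\<close> and, for \<open>n \<ge> 2\<close>, \<open>n v\<^sup>n\<^sup>-\<^sup>2 (u v - d)\<close>. Together with the symmetry
  \<open>z \<leftrightarrow> 1 / z\<close> they determine \<open>u\<close>, \<open>v\<close> and \<open>d\<close>.\<close>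

section \<open>Power sums of the eigenvalues of a 2 x 2 matrix\<close>

text \<open>This is the Dickson polynomial of the first kind: for \<open>t = x + y\<close> and
  \<open>d = x * y\<close> its value is the power sum \<open>x ^ n + y ^ n\<close>.\<close>

fun power_trace :: "nat \<Rightarrow> 'a::comm_ring_1 \<Rightarrow> 'a \<Rightarrow> 'a" where
  "power_trace 0 t d = 2"
| "power_trace (Suc 0) t d = t"
| "power_trace (Suc (Suc n)) t d = t * power_trace (Suc n) t d - d * power_trace n t d"

text \<open>Homogeneity: scaling both eigenvalues by \<open>r\<close> scales their sum by
  \<open>r\<close> and their product by the square of \<open>r\<close>.\<close>

lemma power_trace_scale: "power_trace n (r * t) (r\<^sup>2 * d) = r ^ n * power_trace n t d"
  by (induction n t d rule: power_trace.induct) (simp_all add: algebra_simps power2_eq_square)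

lemma mat_power_Suc: "mat_power A (Suc n) = A ** mat_power A n"
  by (simp add: mat_power_def)

lemma trace_mat_power:
  fixes A :: "'a::comm_ring_1^2^2"
  shows "trace (mat_power A n) = power_trace n (trace A) (det A)"
proof (induction n "trace A" "det A" rule: power_trace.induct)
  case 1
  show ?case by (simp add: mat_power_def trace_I)
next
  case 2
  show ?case by (simp add: mat_power_def)
next
  case (3 n)
  \<comment> \<open>Trace of the Cayley-Hamilton relation multiplied by \<open>M\<close>, which then
    stands for \<open>mat_power A n\<close>.\<close>
  have "trace (A ** (A ** M)) = trace A * trace (A ** M) - det A * trace M" for M
    by (simp add: trace_def sum_2 det_2 matrix_matrix_mult_def algebra_simps)
  with 3 show ?case by (simp add: mat_power_Suc)
qed

lemma mat2_nth [simp]: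
  "mat2 a b c d $ 1 $ 1 = a" "mat2 a b c d $ 1 $ 2 = b"
  "mat2 a b c d $ 2 $ 1 = c" "mat2 a b c d $ 2 $ 2 = d"
  by (simp_all add: mat2_def vector_2)

section \<open>Trace and determinant of \<open>S z G\<close>\<close>

definition column_norm2 :: "complex^2^2 \<Rightarrow> 2 \<Rightarrow> real" where
  "column_norm2 G j = (cmod (G $ 1 $ j))\<^sup>2 + (cmod (G $ 2 $ j))\<^sup>2"

lemma generic_iff: "generic G \<longleftrightarrow> 0 < column_norm2 G 1 \<and> 0 < column_norm2 G 2"
  by (auto simp: generic_def column_norm2_def sum_power2_gt_zero_iff sum_power2_eq_zero_iff)

lemma trace_S:
  "trace (S z G) = of_real (column_norm2 G 1) * z + of_real (column_norm2 G 2) / z"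
  by (simp add: S_def adjoint_mat_def map_matrix_def transpose_def trace_def sum_2
      matrix_matrix_mult_def column_norm2_def complex_norm_square divide_inverse algebra_simps
      del: of_real_power)

lemma det_S:
  assumes "z \<noteq> 0"
  shows "det (S z G) = of_real ((cmod (det G))\<^sup>2)"
proof -
  have "det (mat2 z 0 0 (inverse z)) = 1"
    using assms by (simp add: det_2)
  moreover have "det (adjoint_mat G) = cnj (det G)"
    by (simp add: det_2 adjoint_mat_def map_matrix_def transpose_def)
  ultimately show ?thesis
    by (simp add: S_def det_mul complex_norm_square del: of_real_power)
qed

lemma L_eq_power_trace:
  assumes "z \<noteq> 0"
  shows "L n z G = power_trace n
    (of_real (column_norm2 G 1) * z + of_real (column_norm2 G 2) / z) (of_real ((cmod (det G))\<^sup>2))"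
  using assms by (simp add: L_def trace_mat_power trace_S det_S del: of_real_power)

lemma det_F: "det (F \<theta>) = of_real (cos (2 * \<theta>))"
  by (simp add: F_def det_2 cos_double power2_eq_square)

lemma column_norm2_F: "column_norm2 (F \<theta>) 1 = 1" "column_norm2 (F \<theta>) 2 = 1"
  by (simp_all add: column_norm2_def F_def)

text \<open>The columns of \<open>F \<theta>\<close> have norm 1, so by homogeneity \<open>R\<close>
  and \<open>\<rho>\<close> enter only through the trace and the determinant. This is the normal
  form with which a general \<open>G\<close> is compared.\<close>

lemma scaled_L_F:
  assumes "0 < \<rho>" "z \<noteq> 0"
  shows "of_real R ^ n * L n (of_real \<rho> * z) (F \<theta>) = power_trace n
    (of_real (R * \<rho>) * z + of_real (R / \<rho>) / z) (of_real (R\<^sup>2 * (cos (2 * \<theta>))\<^sup>2))"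
proof -
  have "of_real (R * \<rho>) * z + of_real (R / \<rho>) / z
      = of_real R * (of_real \<rho> * z + 1 / (of_real \<rho> * z))"
    using assms by (simp add: field_simps)
  then show ?thesis
    using assms power_trace_scale[of n "of_real R" "of_real \<rho> * z + 1 / (of_real \<rho> * z)"
        "of_real ((cos (2 * \<theta>))\<^sup>2)"]
    by (simp add: L_eq_power_trace det_F column_norm2_F)
qed

lemma L_eq_scaled_L_F:
  assumes "0 < \<rho>" "z \<noteq> 0" "column_norm2 G 1 = R * \<rho>" "column_norm2 G 2 = R / \<rho>"
    and "(cmod (det G))\<^sup>2 = R\<^sup>2 * (cos (2 * \<theta>))\<^sup>2"
  shows "L n z G = of_real R ^ n * L n (of_real \<rho> * z) (F \<theta>)"
  unfolding scaled_L_F[OF assms(1,2)] L_eq_power_trace[OF assms(2)] assms(3-5) ..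

section \<open>Existence of parameters and of matrices\<close>

lemma hadamard_2: "(cmod (det G))\<^sup>2 \<le> column_norm2 G 1 * column_norm2 G 2"
proof -
  define a b c d where "a = cmod (G $ 1 $ 1)" and "b = cmod (G $ 1 $ 2)"
    and "c = cmod (G $ 2 $ 1)" and "d = cmod (G $ 2 $ 2)"
  have "cmod (det G) \<le> a * d + b * c"
    using norm_triangle_ineq4[of "G $ 1 $ 1 * G $ 2 $ 2" "G $ 1 $ 2 * G $ 2 $ 1"]
    by (simp add: det_2 a_def b_def c_def d_def norm_mult)
  then have "(cmod (det G))\<^sup>2 \<le> (a * d + b * c)\<^sup>2"
    by (rule power_mono) simp
  \<comment> \<open>The added square completes Lagrange's identity: the cross terms
    \<open>2 * a * b * c * d\<close> cancel.\<close>
  also have "\<dots> \<le> (a * d + b * c)\<^sup>2 + (a * b - c * d)\<^sup>2"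
    by simp
  also have "\<dots> = (a\<^sup>2 + c\<^sup>2) * (b\<^sup>2 + d\<^sup>2)"
    by (simp add: power2_eq_square algebra_simps)
  finally show ?thesis
    by (simp add: column_norm2_def a_def b_def c_def d_def)
qed

lemma exists_parameters:
  assumes "generic G"
  shows "\<exists>R \<rho> \<theta>. 0 < R \<and> 0 < \<rho> \<and> \<theta> \<in> {0..pi/4} \<and>
    (\<forall>n\<ge>1. \<forall>z. z \<noteq> 0 \<longrightarrow> L n z G = of_real R ^ n * L n (of_real \<rho> * z) (F \<theta>))"
proof -
  define u v where "u = column_norm2 G 1" and "v = column_norm2 G 2"
  \<comment> \<open>These values solve \<open>u = R * \<rho>\<close> and
    \<open>v = R / \<rho>\<close>.\<close>
  define R \<rho> where "R = sqrt (u * v)" and "\<rho> = sqrt (u / v)"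
  \<comment> \<open>Hadamard's inequality puts the quotient into [0, 1], where \<open>arccos\<close>
    takes values in [0, pi/2]; halving gives the range of \<open>\<theta>\<close>.\<close>
  define \<theta> where "\<theta> = arccos (cmod (det G) / R) / 2"
  have uv: "0 < u" "0 < v"
    using assms by (simp_all add: generic_iff u_def v_def)
  then have pos: "0 < R" "0 < \<rho>" and R2: "R\<^sup>2 = u * v"
    by (simp_all add: R_def \<rho>_def)
  have norms: "column_norm2 G 1 = R * \<rho>" "column_norm2 G 2 = R / \<rho>"
    using uv by (simp_all add: R_def \<rho>_def real_sqrt_mult real_sqrt_divide flip: u_def v_def)
  have "cmod (det G) \<le> R"
    using hadamard_2[of G] pos by (simp add: power2_le_imp_le[of _ R] R2 u_def v_def)
  then have quot: "0 \<le> cmod (det G) / R" "cmod (det G) / R \<le> 1"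
    using pos by simp_all
  then have "cos (2 * \<theta>) = cmod (det G) / R"
    by (simp add: \<theta>_def)
  then have "(cmod (det G))\<^sup>2 = R\<^sup>2 * (cos (2 * \<theta>))\<^sup>2"
    using pos by (simp add: power_divide)
  with norms pos have "L n z G = of_real R ^ n * L n (of_real \<rho> * z) (F \<theta>)" if "z \<noteq> 0" for n z
    using that by (intro L_eq_scaled_L_F)
  moreover have "\<theta> \<in> {0..pi/4}"
    using quot arccos_le_pi2[of "cmod (det G) / R"] arccos_lbound[of "cmod (det G) / R"]
    by (simp add: \<theta>_def)
  ultimately show ?thesis
    using pos by blast
qed

lemma exists_matrix:
  assumes "0 < R" "0 < \<rho>"
  shows "\<exists>G. generic G \<and>
    (\<forall>n\<ge>1. \<forall>z. z \<noteq> 0 \<longrightarrow> L n z G = of_real R ^ n * L n (of_real \<rho> * z) (F \<theta>))"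
proof -
  \<comment> \<open>The diagonal factor below scales the unit columns of \<open>F \<theta>\<close>,
    so \<open>a\<close> and \<open>b\<close> are the prescribed column norms.\<close>
  define a b where "a = sqrt (R * \<rho>)" and "b = sqrt (R / \<rho>)"
  have ab: "a\<^sup>2 = R * \<rho>" "b\<^sup>2 = R / \<rho>" "a * b = R"
    using assms by (simp_all add: a_def b_def flip: real_sqrt_mult)
  define G where "G = F \<theta> ** mat2 (of_real a) 0 0 (of_real b)"
  have "column_norm2 G 1 = a\<^sup>2 * ((cos \<theta>)\<^sup>2 + (sin \<theta>)\<^sup>2)"
       "column_norm2 G 2 = b\<^sup>2 * ((cos \<theta>)\<^sup>2 + (sin \<theta>)\<^sup>2)"
    by (simp_all add: column_norm2_def G_def F_def matrix_matrix_mult_def sum_2 norm_mult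
        power_mult_distrib algebra_simps del: sin_cos_squared_add sin_cos_squared_add2)
  then have norms: "column_norm2 G 1 = R * \<rho>" "column_norm2 G 2 = R / \<rho>"
    by (simp_all add: ab)
  have "det (mat2 (of_real a) 0 0 (of_real b)) = complex_of_real (a * b)"
    by (simp add: det_2)
  then have "det G = of_real (a * b * cos (2 * \<theta>))"
    by (simp add: G_def det_mul det_F)
  then have "(cmod (det G))\<^sup>2 = R\<^sup>2 * (cos (2 * \<theta>))\<^sup>2"
    by (simp add: ab norm_mult power_mult_distrib del: of_real_mult)
  with norms assms show ?thesis
    by (intro exI[of _ G]) (simp add: generic_iff L_eq_scaled_L_F)
qed

section \<open>Recovering the coefficients and the parameters\<close>

text \<open>The indeterminate stands for \<open>z\<^sup>2\<close>. Multiplication by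
  \<open>z ^ n\<close> turns the trace \<open>u * z + v / z\<close> into
  \<open>v + u * z\<^sup>2\<close>, and the index gap of two in the recurrence leaves a factor
  \<open>z\<^sup>2\<close> at \<open>d\<close>.\<close>

fun laurent_poly :: "'a::comm_ring_1 \<Rightarrow> 'a \<Rightarrow> 'a \<Rightarrow> nat \<Rightarrow> 'a poly" where
  "laurent_poly u v d 0 = [:2:]"
| "laurent_poly u v d (Suc 0) = [:v, u:]"
| "laurent_poly u v d (Suc (Suc n)) =
    [:v, u:] * laurent_poly u v d (Suc n) - [:0, d:] * laurent_poly u v d n"

lemma poly_laurent_poly:
  fixes z :: "'a::field"
  assumes "z \<noteq> 0"
  shows "poly (laurent_poly u v d n) (z\<^sup>2) = z ^ n * power_trace n (u * z + v / z) d"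
  using assms
  by (induction u v d n rule: laurent_poly.induct)
    (simp_all add: field_simps power2_eq_square)

lemma coeff_0_laurent_poly: "0 < n \<Longrightarrow> coeff (laurent_poly u v d n) 0 = v ^ n"
  by (induction u v d n rule: laurent_poly.induct) (auto simp: coeff_mult)

text \<open>The base case is \<open>(v + u * x)\<^sup>2 - 2 * d * x\<close>. Each step multiplies by
  \<open>v\<close> and adds one more \<open>v ^ (n + 1) * (u * v - d)\<close>, whence the factor
  \<open>n + 2\<close>.\<close>

lemma coeff_1_laurent_poly:
  "coeff (laurent_poly u v d (n + 2)) 1 = of_nat (n + 2) * v ^ n * (u * v - d)"
proof (induction n)
  case 0
  show ?case by (simp add: coeff_pCons algebra_simps)
next
  case (Suc n)
  have "coeff (laurent_poly u v d (Suc n + 2)) 1 = v * coeff (laurent_poly u v d (n + 2)) 1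
      + u * coeff (laurent_poly u v d (n + 2)) 0 - d * coeff (laurent_poly u v d (n + 1)) 0"
    by (simp add: coeff_pCons)
  then show ?case
    unfolding Suc.IH by (simp add: coeff_0_laurent_poly algebra_simps del: laurent_poly.simps)
qed

lemma laurent_poly_cong:
  fixes u1 :: complex
  assumes "\<And>z. z \<noteq> 0 \<Longrightarrow>
    power_trace n (u1 * z + v1 / z) d1 = power_trace n (u2 * z + v2 / z) d2"
  shows "laurent_poly u1 v1 d1 n = laurent_poly u2 v2 d2 n"
proof -
  let ?p = "laurent_poly u1 v1 d1 n" and ?q = "laurent_poly u2 v2 d2 n"
  have "poly ?p x = poly ?q x" if "x \<noteq> 0" for x
    using assms[of "csqrt x"] poly_laurent_poly[of "csqrt x"] that by simp
  \<comment> \<open>The extra factor vanishes at 0, the one point about which the hypothesis says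
    nothing; it is cancelled afterwards.\<close>
  then have "poly ([:0, 1:] * ?p) = poly ([:0, 1:] * ?q)"
    by force
  then show ?thesis
    unfolding poly_eq_poly_eq_iff by simp
qed

lemma power_trace_coeffs_unique:
  fixes u1 v1 d1 u2 v2 d2 :: real
  assumes pos: "0 < u1" "0 < v1" "0 < u2" "0 < v2" and n: "0 < n"
    and eq: "\<And>z::complex. z \<noteq> 0 \<Longrightarrow>
      power_trace n (of_real u1 * z + of_real v1 / z) (of_real d1)
      = power_trace n (of_real u2 * z + of_real v2 / z) (of_real d2)"
  shows "u1 = u2" "v1 = v2" "2 \<le> n \<Longrightarrow> d1 = d2"
proof -
  let ?P = "\<lambda>u v d. laurent_poly (complex_of_real u) (of_real v) (of_real d) n"
  have P: "?P u1 v1 d1 = ?P u2 v2 d2"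
    using eq by (rule laurent_poly_cong)
  \<comment> \<open>Replacing \<open>z\<close> by \<open>1 / z\<close> exchanges \<open>u\<close>
    and \<open>v\<close>, so \<open>u ^ n\<close> becomes a lowest coefficient too.\<close>
  have "?P v1 u1 d1 = ?P v2 u2 d2"
  proof (rule laurent_poly_cong)
    fix z :: complex
    assume "z \<noteq> 0"
    then show "power_trace n (of_real v1 * z + of_real u1 / z) (of_real d1)
        = power_trace n (of_real v2 * z + of_real u2 / z) (of_real d2)"
      using eq[of "1 / z"] by (simp add: add.commute)
  qed
  then have "complex_of_real (u1 ^ n) = of_real (u2 ^ n)"
    using n by (metis coeff_0_laurent_poly of_real_power)
  then have "u1 ^ n = u2 ^ n"
    unfolding of_real_eq_iff .
  then show u: "u1 = u2"
    using pos n by (simp add: power_eq_iff_eq_base)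
  have "complex_of_real (v1 ^ n) = of_real (v2 ^ n)"
    using n P by (metis coeff_0_laurent_poly of_real_power)
  then have "v1 ^ n = v2 ^ n"
    unfolding of_real_eq_iff .
  then show v: "v1 = v2"
    using pos n by (simp add: power_eq_iff_eq_base)
  assume "2 \<le> n"
  then obtain m where m: "n = m + 2"
    by (metis add.commute le_Suc_ex)
  \<comment> \<open>With \<open>u\<close> and \<open>v\<close> already identified, the second lowest
    coefficients can differ only through \<open>d\<close>.\<close>
  have "of_nat (m + 2) * complex_of_real v1 ^ m * (of_real u1 * of_real v1 - of_real d1)
      = of_nat (m + 2) * of_real v1 ^ m * (of_real u1 * of_real v1 - of_real d2)"
    using P unfolding m u v by (metis coeff_1_laurent_poly)
  moreover have "of_nat (m + 2) * complex_of_real v1 ^ m \<noteq> 0"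
    using pos by (metis Suc_1 add_Suc_right mult_eq_0_iff of_nat_neq_0 of_real_eq_0_iff order_less_irrefl
        power_not_zero)
  ultimately show "d1 = d2"
    using pos by auto
qed

lemma parameters_unique:
  assumes pos: "0 < R1" "0 < \<rho>1" "0 < R2" "0 < \<rho>2" and n: "0 < n"
    and \<theta>: "\<theta>1 \<in> {0..pi/4}" "\<theta>2 \<in> {0..pi/4}"
    and eq: "\<forall>z. z \<noteq> 0 \<longrightarrow> of_real R1 ^ n * L n (of_real \<rho>1 * z) (F \<theta>1)
      = of_real R2 ^ n * L n (of_real \<rho>2 * z) (F \<theta>2)"
  shows "R1 = R2" "\<rho>1 = \<rho>2" "2 \<le> n \<Longrightarrow> \<theta>1 = \<theta>2"
proof -
  have eq': "power_trace n (of_real (R1 * \<rho>1) * z + of_real (R1 / \<rho>1) / z)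
        (of_real (R1\<^sup>2 * (cos (2 * \<theta>1))\<^sup>2))
      = power_trace n (of_real (R2 * \<rho>2) * z + of_real (R2 / \<rho>2) / z)
        (of_real (R2\<^sup>2 * (cos (2 * \<theta>2))\<^sup>2))" if "z \<noteq> 0" for z :: complex
    using eq that pos by (metis scaled_L_F)
  note unique = power_trace_coeffs_unique[OF _ _ _ _ n eq']
  have u: "R1 * \<rho>1 = R2 * \<rho>2" and v: "R1 / \<rho>1 = R2 / \<rho>2"
    using unique pos by simp_all
  \<comment> \<open>Multiplying the two squared column norms eliminates
    \<open>\<rho>\<close>.\<close>
  have "R1\<^sup>2 = (R1 * \<rho>1) * (R1 / \<rho>1)" "R2\<^sup>2 = (R2 * \<rho>2) * (R2 / \<rho>2)"
    using pos by (simp_all add: power2_eq_square)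
  then have "R1\<^sup>2 = R2\<^sup>2"
    by (simp only: u v)
  then show R: "R1 = R2"
    using pos by (simp add: power2_eq_iff_nonneg)
  then show "\<rho>1 = \<rho>2"
    using u pos by simp
  assume "2 \<le> n"
  then have "R1\<^sup>2 * (cos (2 * \<theta>1))\<^sup>2 = R2\<^sup>2 * (cos (2 * \<theta>2))\<^sup>2"
    using unique(3) pos by simp
  then have "(cos (2 * \<theta>1))\<^sup>2 = (cos (2 * \<theta>2))\<^sup>2"
    using R pos by simp
  \<comment> \<open>The doubled angles lie in [0, pi/2], where the cosine is nonnegative and
    injective, so its square determines the angle.\<close>
  moreover have "0 \<le> cos (2 * \<theta>1)" "0 \<le> cos (2 * \<theta>2)"
    using \<theta> by (auto intro!: cos_ge_zero)
  ultimately have "cos (2 * \<theta>1) = cos (2 * \<theta>2)"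
    by (simp add: power2_eq_iff_nonneg)
  then have "2 * \<theta>1 = 2 * \<theta>2"
    using \<theta> by (intro cos_inj_pi[of "2 * \<theta>1" "2 * \<theta>2"]) simp_all
  then show "\<theta>1 = \<theta>2"
    by simp
qed

theorem theorem3p1:
  shows
    "(\<forall>G. generic G \<longrightarrow>
        (\<exists>R \<rho> \<theta>. 0 < R \<and> 0 < \<rho> \<and> \<theta> \<in> {0..pi/4} \<and>
          (\<forall>n\<ge>1. \<forall>z. z \<noteq> 0 \<longrightarrow>
            L n z G = of_real R ^ n * L n (of_real \<rho> * z) (F \<theta>))))
   \<and> (\<forall>R \<rho> \<theta>. 0 < R \<and> 0 < \<rho> \<and> \<theta> \<in> {0..pi/4} \<longrightarrow>
        (\<exists>G. generic G \<and>
          (\<forall>n\<ge>1. \<forall>z. z \<noteq> 0 \<longrightarrow>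
            L n z G = of_real R ^ n * L n (of_real \<rho> * z) (F \<theta>))))
   \<and> (\<forall>R1 \<rho>1 \<theta>1 R2 \<rho>2 \<theta>2.
        0 < R1 \<and> 0 < \<rho>1 \<and> \<theta>1 \<in> {0..pi/4} \<and> 0 < R2 \<and> 0 < \<rho>2 \<and> \<theta>2 \<in> {0..pi/4} \<longrightarrow>
        ((\<exists>n\<ge>2. \<forall>z. z \<noteq> 0 \<longrightarrow>
            of_real R1 ^ n * L n (of_real \<rho>1 * z) (F \<theta>1)
            = of_real R2 ^ n * L n (of_real \<rho>2 * z) (F \<theta>2))
          \<longrightarrow> R1 = R2 \<and> \<rho>1 = \<rho>2 \<and> \<theta>1 = \<theta>2)
        \<and> ((\<forall>z. z \<noteq> 0 \<longrightarrow>
            of_real R1 * L 1 (of_real \<rho>1 * z) (F \<theta>1)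
            = of_real R2 * L 1 (of_real \<rho>2 * z) (F \<theta>2))
          \<longrightarrow> R1 = R2 \<and> \<rho>1 = \<rho>2))
   \<and> (\<forall>R \<rho> \<theta>1 \<theta>2. 0 < R \<and> 0 < \<rho> \<and> \<theta>1 \<in> {0..pi/4} \<and> \<theta>2 \<in> {0..pi/4} \<longrightarrow>
        (\<forall>z. z \<noteq> 0 \<longrightarrow>
          of_real R * L 1 (of_real \<rho> * z) (F \<theta>1) = of_real R * L 1 (of_real \<rho> * z) (F \<theta>2)))"
proof (intro conjI allI impI)
  fix G :: "complex^2^2"
  assume "generic G"
  then show "\<exists>R \<rho> \<theta>. 0 < R \<and> 0 < \<rho> \<and> \<theta> \<in> {0..pi/4} \<and>
    (\<forall>n\<ge>1. \<forall>z. z \<noteq> 0 \<longrightarrow> L n z G = of_real R ^ n * L n (of_real \<rho> * z) (F \<theta>))"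
    by (rule exists_parameters)
next
  fix R \<rho> \<theta> :: real
  assume "0 < R \<and> 0 < \<rho> \<and> \<theta> \<in> {0..pi/4}"
  then show "\<exists>G. generic G \<and>
    (\<forall>n\<ge>1. \<forall>z. z \<noteq> 0 \<longrightarrow> L n z G = of_real R ^ n * L n (of_real \<rho> * z) (F \<theta>))"
    by (intro exists_matrix) auto
next
  fix R1 \<rho>1 \<theta>1 R2 \<rho>2 \<theta>2 :: real
  assume *: "0 < R1 \<and> 0 < \<rho>1 \<and> \<theta>1 \<in> {0..pi/4} \<and> 0 < R2 \<and> 0 < \<rho>2 \<and> \<theta>2 \<in> {0..pi/4}"
  {
    assume "\<exists>n\<ge>2. \<forall>z. z \<noteq> 0 \<longrightarrow> of_real R1 ^ n * L n (of_real \<rho>1 * z) (F \<theta>1)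
      = of_real R2 ^ n * L n (of_real \<rho>2 * z) (F \<theta>2)"
    then obtain n where n: "2 \<le> n"
      and eq: "\<forall>z. z \<noteq> 0 \<longrightarrow> of_real R1 ^ n * L n (of_real \<rho>1 * z) (F \<theta>1)
        = of_real R2 ^ n * L n (of_real \<rho>2 * z) (F \<theta>2)"
      by blast
    show "R1 = R2" "\<rho>1 = \<rho>2" "\<theta>1 = \<theta>2"
      using parameters_unique[OF _ _ _ _ _ _ _ eq] * n by auto
  }
  {
    assume "\<forall>z. z \<noteq> 0 \<longrightarrow> of_real R1 * L 1 (of_real \<rho>1 * z) (F \<theta>1)
      = of_real R2 * L 1 (of_real \<rho>2 * z) (F \<theta>2)"
    then show "R1 = R2" "\<rho>1 = \<rho>2"
      using parameters_unique[of R1 \<rho>1 R2 \<rho>2 1 \<theta>1 \<theta>2] * by auto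
  }
next
  fix R \<rho> \<theta>1 \<theta>2 :: real and z :: complex
  assume "0 < R \<and> 0 < \<rho> \<and> \<theta>1 \<in> {0..pi/4} \<and> \<theta>2 \<in> {0..pi/4}" "z \<noteq> 0"
  then show "of_real R * L 1 (of_real \<rho> * z) (F \<theta>1) = of_real R * L 1 (of_real \<rho> * z) (F \<theta>2)"
    \<comment> \<open>At \<open>n = 1\<close> only the trace remains, while \<open>\<theta>\<close>
      affects only the determinant.\<close>
    by (simp add: L_eq_power_trace column_norm2_F)
qed

end
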